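(* Let $E$ be a nonzero reflexive real Banach space and let $S : E \rightrightarrows E^*$ be maximally monotone. Then $S$ is quasidense.
   Context: For a multifunction $S : E \rightrightarrows E^*$, $G(S) := \{(x,x^* ) : x^* \in Sx\}$ is its graph; $S$ is maximally monotone if $G(S)$ is a maximally monotone subset of $E \times E^*$. $S$ is quasidense if, for all $(x,x^* ) \in E \times E^*$, $\inf_{(s,s^* ) \in G(S)}\big[\frac12\|s-x\|^2 + \frac12\|s^*-x^*\|^2 + \langle s-x, s^*-x^*\rangle\big] \le 0$. *)

theory Defs
  imports "HOL-Analysis.Analysis"
begin

text \<open>
  The dual of a real normed space \<open>'a\<close> is the library type \<open>'a \<Rightarrow>\<^sub>L real\<close> with its operator norm.
\<close>

type_synonym 'a dual = "'a \<Rightarrow>\<^sub>L real"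

definition canonical_embedding :: "'a::real_normed_vector \<Rightarrow> 'a dual dual"
  where "canonical_embedding x = Blinfun (\<lambda>f. blinfun_apply f x)"

lemma canonical_embedding_apply [simp]:
  "blinfun_apply (canonical_embedding x) f = blinfun_apply f x"
  unfolding canonical_embedding_def
  by (simp add: bounded_linear_Blinfun_apply blinfun.bounded_linear_left)

definition reflexive_space :: "'a::real_normed_vector itself \<Rightarrow> bool"
  where "reflexive_space _ \<longleftrightarrow> surj (canonical_embedding :: 'a \<Rightarrow> 'a dual dual)"

definition graph_of :: "('a::real_normed_vector \<Rightarrow> 'a dual set) \<Rightarrow> ('a \<times> 'a dual) set"
  where "graph_of S = {(x, x'). x' \<in> S x}"

definition monotone_set :: "('a::real_normed_vector \<times> 'a dual) set \<Rightarrow> bool"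
  where "monotone_set A \<longleftrightarrow>
    (\<forall>(x, x') \<in> A. \<forall>(y, y') \<in> A. blinfun_apply (x' - y') (x - y) \<ge> 0)"

definition maximally_monotone_set :: "('a::real_normed_vector \<times> 'a dual) set \<Rightarrow> bool"
  where "maximally_monotone_set A \<longleftrightarrow>
    monotone_set A \<and> (\<forall>B. monotone_set B \<longrightarrow> A \<subseteq> B \<longrightarrow> B = A)"

definition maximally_monotone :: "('a::real_normed_vector \<Rightarrow> 'a dual set) \<Rightarrow> bool"
  where "maximally_monotone S \<longleftrightarrow> maximally_monotone_set (graph_of S)"

text \<open>
  The infimum is taken in the extended reals, so that over an empty graph it is \<open>\<infinity>\<close>; the real
  \<open>Inf {}\<close> would be an unspecified number.
\<close>

definition quasidense :: "('a::real_normed_vector \<Rightarrow> 'a dual set) \<Rightarrow> bool"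
  where "quasidense S \<longleftrightarrow>
    (\<forall>x x'. (INF (s, s') \<in> graph_of S.
        ereal ((norm (s - x))\<^sup>2 / 2 + (norm (s' - x'))\<^sup>2 / 2 + blinfun_apply (s' - x') (s - x))) \<le> 0)"

end

theory Submission
  imports Defs
begin

text \<open>
  The proof shows that the infimum in the definition of quasidensity is attained and is \<open>\<le> 0\<close>.
  Translating the graph reduces this to the origin, so let \<open>A\<close> be maximally monotone; a point
  \<open>(y, y') \<in> A\<close> with \<open>\<parallel>y\<parallel>\<^sup>2/2 + \<parallel>y'\<parallel>\<^sup>2/2 + \<langle>y, y'\<rangle> \<le> 0\<close> is wanted.

  The Fitzpatrick function \<open>\<phi>(x, x') = sup {\<langle>x, s'\<rangle> + \<langle>s, x'\<rangle> - \<langle>s, s'\<rangle> | (s, s') \<in> A}\<close> is convex. By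
  maximality \<open>\<phi>(x, x') \<ge> \<langle>x, x'\<rangle>\<close> everywhere (\<open>pairing_le_fitzpatrick\<close>), and by monotonicity
  \<open>\<phi>(s, s') \<le> \<langle>s, s'\<rangle>\<close> on \<open>A\<close> (\<open>graph_in_fitzpatrick_epigraph\<close>). Hence \<open>\<phi>(z) \<ge> - \<parallel>z\<parallel>\<^sup>2/2\<close> for the
  Hilbert sum norm on the product, and the Hahn-Banach theorem in the form of a sandwich theorem
  (\<open>convex_sandwich\<close>) puts an affine function between the concave function \<open>- \<parallel>z\<parallel>\<^sup>2/2\<close> and the
  convex function \<open>\<phi>\<close>. Its linear part consists of some \<open>y'\<close> in the dual and some \<open>y''\<close> in the
  bidual; reflexivity turns \<open>y''\<close> into a point \<open>y\<close>. Since \<open>\<parallel>\<cdot>\<parallel>\<^sup>2/2\<close> is its own conjugate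
  (\<open>half_norm_square_conjugate\<close>), the sandwich says that

    \<open>\<parallel>y\<parallel>\<^sup>2/2 + \<parallel>y'\<parallel>\<^sup>2/2 \<le> \<langle>s, s'\<rangle> - \<langle>s, y'\<rangle> - \<langle>y, s'\<rangle>\<close> for all \<open>(s, s') \<in> A\<close>.

  Adding \<open>\<langle>y, y'\<rangle>\<close> makes the left side nonnegative and the right side \<open>\<langle>s - y, s' - y'\<rangle>\<close>, so \<open>(y, y')\<close>
  is monotonically related to \<open>A\<close> and lies in \<open>A\<close> by maximality. The same inequality at
  \<open>(s, s') = (y, y')\<close> then is the required one.

  The Hahn-Banach theorem itself is obtained by Zorn's lemma applied to sublinear functions: a
  pointwise minimal one is linear.
\<close>

section \<open>Linear minorants of sublinear and convex functions\<close>

text \<open>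
  Applied to \<open>c\<close> and \<open>1 / c\<close>, the one-sided homogeneity condition gives equality; the inequality is all
  that has to be checked for a function defined as an infimum.
\<close>

definition sublinear :: "('v::real_vector \<Rightarrow> real) \<Rightarrow> bool"
  where "sublinear p \<longleftrightarrow>
    (\<forall>x y. p (x + y) \<le> p x + p y) \<and> (\<forall>c>0. \<forall>x. p (c *\<^sub>R x) \<le> c * p x)"

lemma sublinear_add: "sublinear p \<Longrightarrow> p (x + y) \<le> p x + p y"
  and sublinear_scale: "sublinear p \<Longrightarrow> c > 0 \<Longrightarrow> p (c *\<^sub>R x) \<le> c * p x"
  by (simp_all add: sublinear_def)

lemma sublinear_zero:
  assumes "sublinear p" shows "p 0 = 0"
proof -
  have "p ((1/2) *\<^sub>R 0) \<le> 1/2 * p 0" "p (2 *\<^sub>R 0) \<le> 2 * p 0"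
    by (intro sublinear_scale[OF assms]; simp)+
  then show ?thesis by simp
qed

lemma sublinear_minus:
  assumes "sublinear p" shows "- p (- x) \<le> p x"
proof -
  have "p (x + - x) \<le> p x + p (- x)" by (rule sublinear_add[OF assms])
  then show ?thesis using sublinear_zero[OF assms] by simp
qed

text \<open>
  The common majorant \<open>p\<close> keeps the infimum finite: \<open>q x \<ge> - q (- x) \<ge> - p (- x)\<close> for every \<open>q\<close> in the
  chain. The infimum is subadditive because the two infima on the right may be approximated by one and
  the same member of the chain, the smaller of two given ones.
\<close>

lemma sublinear_Inf_chain:
  fixes C :: "('v::real_vector \<Rightarrow> real) set"
  assumes ne: "C \<noteq> {}" and sub: "\<And>q. q \<in> C \<Longrightarrow> sublinear q"
    and bd: "\<And>q x. q \<in> C \<Longrightarrow> q x \<le> p x"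
    and chain: "\<And>q q'. q \<in> C \<Longrightarrow> q' \<in> C \<Longrightarrow> (\<forall>x. q x \<le> q' x) \<or> (\<forall>x. q' x \<le> q x)"
  shows "sublinear (\<lambda>x. INF q\<in>C. q x)" and "\<And>q x. q \<in> C \<Longrightarrow> (INF q\<in>C. q x) \<le> q x"
proof -
  have below: "bdd_below ((\<lambda>q. q x) ` C)" for x
  proof (rule bdd_belowI2)
    fix q assume "q \<in> C"
    then show "- p (- x) \<le> q x"
      using sublinear_minus[OF sub, of q x] bd[of q "- x"] by linarith
  qed
  show lower: "(INF q\<in>C. q x) \<le> q x" if "q \<in> C" for q x
    using cINF_lower[OF below that] .
  have add: "(INF q\<in>C. q (x + y)) \<le> (INF q\<in>C. q x) + (INF q\<in>C. q y)" for x y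
  proof -
    have *: "(INF q\<in>C. q (x + y)) \<le> q x + q' y" if "q \<in> C" "q' \<in> C" for q q'
    proof -
      obtain m where m: "m \<in> C" "\<And>z. m z \<le> q z" "\<And>z. m z \<le> q' z"
        using chain[OF \<open>q \<in> C\<close> \<open>q' \<in> C\<close>] \<open>q \<in> C\<close> \<open>q' \<in> C\<close> by (metis order_refl)
      have "m (x + y) \<le> m x + m y" using sub[OF m(1)] by (simp add: sublinear_def)
      then show ?thesis using lower[OF m(1), of "x + y"] m(2)[of x] m(3)[of y] by linarith
    qed
    have "(INF q\<in>C. q (x + y)) - q x \<le> (INF q'\<in>C. q' y)" if "q \<in> C" for q
      by (rule cINF_greatest[OF ne]) (use *[OF that] in \<open>simp add: algebra_simps\<close>)
    then have "(INF q\<in>C. q (x + y)) - (INF q'\<in>C. q' y) \<le> (INF q\<in>C. q x)"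
      by (intro cINF_greatest[OF ne]) (simp add: algebra_simps)
    then show ?thesis by linarith
  qed
  have scale: "(INF q\<in>C. q (c *\<^sub>R x)) \<le> c * (INF q\<in>C. q x)" if "c > 0" for c x
  proof -
    have "(INF q\<in>C. q (c *\<^sub>R x)) / c \<le> (INF q\<in>C. q x)"
    proof (rule cINF_greatest[OF ne])
      fix q assume q: "q \<in> C"
      have "q (c *\<^sub>R x) \<le> c * q x" using sub[OF q] that by (simp add: sublinear_def)
      then have "(INF q\<in>C. q (c *\<^sub>R x)) \<le> c * q x" using lower[OF q, of "c *\<^sub>R x"] by linarith
      then show "(INF q\<in>C. q (c *\<^sub>R x)) / c \<le> q x" using that by (simp add: field_simps)
    qed
    then show ?thesis using that by (simp add: field_simps)
  qed
  show "sublinear (\<lambda>x. INF q\<in>C. q x)" using add scale by (simp add: sublinear_def)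
qed

text \<open>
  For fixed \<open>y\<close>, the function \<open>r x = inf {q (x + t y) - t q y | t \<ge> 0}\<close> is a sublinear minorant of \<open>q\<close>, so
  by minimality it is \<open>q\<close>. The value at \<open>t = 1\<close> then gives \<open>q x + q y \<le> q (x + y)\<close>, so \<open>q\<close> is additive.
\<close>

lemma minimal_sublinear_is_linear:
  fixes q :: "'v::real_vector \<Rightarrow> real"
  assumes q: "sublinear q"
    and min: "\<And>q'. sublinear q' \<Longrightarrow> (\<And>x. q' x \<le> q x) \<Longrightarrow> q' = q"
  shows "linear q"
proof -
  have qadd: "q (x + y) \<le> q x + q y" for x y using q by (simp add: sublinear_def)
  have qscale: "q (c *\<^sub>R x) \<le> c * q x" if "c > 0" for c x using q that by (simp add: sublinear_def)
  have super: "q x + q y \<le> q (x + y)" for x y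
  proof -
    define r where "r x = (INF t\<in>{0..}. q (x + t *\<^sub>R y) - t * q y)" for x
    have lb: "- q (- x) \<le> q (x + t *\<^sub>R y) - t * q y" if "t \<ge> 0" for t x
    proof -
      have "q (t *\<^sub>R y) \<le> q (x + t *\<^sub>R y) + q (- x)" using qadd[of "x + t *\<^sub>R y" "- x"] by simp
      moreover have "t * q y \<le> q (t *\<^sub>R y)"
      proof (cases "t = 0")
        case False
        then have "q ((1 / t) *\<^sub>R (t *\<^sub>R y)) \<le> (1 / t) * q (t *\<^sub>R y)"
          using that by (intro qscale) simp
        then show ?thesis using False that by (simp add: field_simps)
      qed (simp add: sublinear_zero[OF q])
      ultimately show ?thesis by linarith
    qed
    have low: "r x \<le> q (x + t *\<^sub>R y) - t * q y" if "t \<ge> 0" for t x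
      unfolding r_def by (rule cINF_lower) (use that lb in \<open>auto intro!: bdd_belowI2\<close>)
    have gr: "m \<le> r x" if "\<And>t. t \<ge> 0 \<Longrightarrow> m \<le> q (x + t *\<^sub>R y) - t * q y" for m x
      unfolding r_def by (rule cINF_greatest) (use that in auto)
    have "sublinear r"
      unfolding sublinear_def
    proof (intro conjI allI impI)
      fix u v
      have "r (u + v) \<le> (q (u + t *\<^sub>R y) - t * q y) + (q (v + s *\<^sub>R y) - s * q y)"
        if "t \<ge> 0" "s \<ge> 0" for s t
        using low[of "t + s" "u + v"] qadd[of "u + t *\<^sub>R y" "v + s *\<^sub>R y"] that
        by (simp add: algebra_simps)
      then have "r (u + v) - (q (u + t *\<^sub>R y) - t * q y) \<le> r v" if "t \<ge> 0" for t
        using that by (intro gr) (smt (verit))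
      then have "r (u + v) - r v \<le> r u"
        by (intro gr) (simp add: algebra_simps)
      then show "r (u + v) \<le> r u + r v" by linarith
    next
      fix c :: real and u assume c: "c > 0"
      have "r (c *\<^sub>R u) / c \<le> r u"
      proof (rule gr)
        fix t :: real assume "t \<ge> 0"
        then have "r (c *\<^sub>R u) \<le> c * (q (u + t *\<^sub>R y) - t * q y)"
          using low[of "c * t" "c *\<^sub>R u"] qscale[OF c, of "u + t *\<^sub>R y"] c
          by (simp add: algebra_simps)
        then show "r (c *\<^sub>R u) / c \<le> q (u + t *\<^sub>R y) - t * q y"
          using c by (simp add: field_simps)
      qed
      then show "r (c *\<^sub>R u) \<le> c * r u" using c by (simp add: field_simps)
    qed
    moreover have "r x \<le> q x" for x using low[of 0 x] by simp
    ultimately have "r = q" by (rule min)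
    then show ?thesis using low[of 1 x] by simp
  qed
  have add: "q (x + y) = q x + q y" for x y using super qadd by (meson antisym)
  have neg: "q (- x) = - q x" for x using add[of x "- x"] sublinear_zero[OF q] by simp
  have pos: "q (c *\<^sub>R x) = c * q x" if "c > 0" for c x
  proof (rule antisym)
    have "q ((- c) *\<^sub>R x) \<le> c * q (- x)" using qscale[OF that, of "- x"] by simp
    then show "c * q x \<le> q (c *\<^sub>R x)" using neg by simp
  qed (rule qscale[OF that])
  show ?thesis
  proof (rule linearI)
    fix c x show "q (c *\<^sub>R x) = c *\<^sub>R q x"
    proof (cases c "0::real" rule: linorder_cases)
      case less then show ?thesis using pos[of "- c" x] neg by simp
    next
      case greater then show ?thesis using pos by simp
    qed (simp add: sublinear_zero[OF q])
  qed (rule add)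
qed

text \<open>The Hahn-Banach theorem.\<close>

lemma linear_below_sublinear:
  fixes p :: "'v::real_vector \<Rightarrow> real"
  assumes p: "sublinear p"
  obtains l where "linear l" "\<And>x. l x \<le> p x"
proof -
  define A where "A = {q. sublinear q \<and> (\<forall>x. q x \<le> p x)}"
  define P where "P q q' \<longleftrightarrow> (\<forall>x. q' x \<le> q x)" for q q' :: "'v \<Rightarrow> real"
  have po: "partial_order_on A (relation_of P A)"
    unfolding partial_order_on_def preorder_on_def relation_of_def
    by (auto simp: refl_on_def trans_def antisym_def P_def fun_eq_iff intro: order_trans)
      (meson antisym)
  have "\<exists>m\<in>A. \<forall>q\<in>A. P m q \<longrightarrow> q = m"
  proof (rule predicate_Zorn[OF po])
    fix C assume C: "C \<in> Chains (relation_of P A)"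
    then have CA: "q \<in> A" if "q \<in> C" for q
      using that by (auto simp: Chains_def relation_of_def)
    have ch: "(\<forall>x. q x \<le> q' x) \<or> (\<forall>x. q' x \<le> q x)" if "q \<in> C" "q' \<in> C" for q q'
      using C that by (auto simp: Chains_def relation_of_def P_def)
    show "\<exists>u\<in>A. \<forall>a\<in>C. P a u"
    proof (cases "C = {}")
      case True then show ?thesis using p by (auto simp: A_def)
    next
      case False
      let ?u = "\<lambda>x. INF q\<in>C. q x"
      have sub: "sublinear ?u" and low: "\<And>q x. q \<in> C \<Longrightarrow> ?u x \<le> q x"
        using sublinear_Inf_chain[of C p] False CA ch by (auto simp: A_def)
      obtain q where "q \<in> C" using False by auto
      then have "?u x \<le> p x" for x using low[of q x] CA[of q] by (auto simp: A_def intro: order_trans)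
      then have "?u \<in> A" using sub by (simp add: A_def)
      then show ?thesis using low unfolding P_def by (intro bexI[of _ ?u]) auto
    qed
  qed
  then obtain m where m: "m \<in> A" "\<And>q. q \<in> A \<Longrightarrow> (\<And>x. q x \<le> m x) \<Longrightarrow> q = m"
    unfolding P_def by blast
  have "linear m"
  proof (rule minimal_sublinear_is_linear)
    show "sublinear m" using m(1) by (simp add: A_def)
    fix q assume q: "sublinear q" "\<And>x. q x \<le> m x"
    have "m x \<le> p x" for x using m(1) by (simp add: A_def)
    then have "q x \<le> p x" for x using q(2) order_trans by blast
    then show "q = m" using q by (intro m(2)) (auto simp: A_def)
  qed
  then show thesis using m(1) by (intro that) (auto simp: A_def)
qed

text \<open>
  Replacing \<open>f\<close> by its sublinear minorant \<open>p v = inf {f (t v) / t | t > 0}\<close> reduces the claim to the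
  Hahn-Banach theorem. The condition \<open>f 0 \<ge> 0\<close> is what keeps this infimum finite, with \<open>- f (- v)\<close> as a
  lower bound.
\<close>

lemma linear_below_convex:
  fixes f :: "'v::real_vector \<Rightarrow> real"
  assumes f: "convex_on UNIV f" and f0: "f 0 \<ge> 0"
  obtains l where "linear l" "\<And>x. l x \<le> f x"
proof -
  define p where "p v = (INF t\<in>{0<..}. f (t *\<^sub>R v) / t)" for v
  \<comment> \<open>The scale \<open>u = t s / (t + s)\<close>, for which \<open>1/u = 1/t + 1/s\<close>, makes \<open>u (v + w)\<close> a convex
    combination of \<open>t v\<close> and \<open>s w\<close>.\<close>
  have persp: "f ((t * s / (t + s)) *\<^sub>R (v + w)) / (t * s / (t + s)) \<le> f (t *\<^sub>R v) / t + f (s *\<^sub>R w) / s"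
    if "t > 0" "s > 0" for s t v w
  proof -
    have "f ((s / (t + s)) *\<^sub>R (t *\<^sub>R v) + (t / (t + s)) *\<^sub>R (s *\<^sub>R w))
        \<le> s / (t + s) * f (t *\<^sub>R v) + t / (t + s) * f (s *\<^sub>R w)"
      using that by (intro convex_on_def[THEN iffD1, OF f, THEN conjunct2, rule_format])
         (auto simp: add_divide_distrib[symmetric])
    moreover have "(s / (t + s)) *\<^sub>R (t *\<^sub>R v) + (t / (t + s)) *\<^sub>R (s *\<^sub>R w) = (t * s / (t + s)) *\<^sub>R (v + w)"
      by (simp add: scaleR_add_right mult.commute)
    ultimately have "f ((t * s / (t + s)) *\<^sub>R (v + w)) \<le> s / (t + s) * f (t *\<^sub>R v) + t / (t + s) * f (s *\<^sub>R w)"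
      by simp
    also have "\<dots> = (f (t *\<^sub>R v) / t + f (s *\<^sub>R w) / s) * (t * s / (t + s))"
      using that by (simp add: distrib_right add_divide_distrib) (simp add: mult.commute)
    finally show ?thesis by (rule pos_divide_le_eq[THEN iffD2, rotated]) (use that in simp)
  qed
  have lb: "- f (- v) \<le> f (t *\<^sub>R v) / t" if "t > 0" for t v
  proof -
    have "0 \<le> f ((t * 1 / (t + 1)) *\<^sub>R (v + - v)) / (t * 1 / (t + 1))" using f0 that by simp
    also have "\<dots> \<le> f (t *\<^sub>R v) / t + f (1 *\<^sub>R - v) / 1" using that by (intro persp) auto
    finally show ?thesis by simp
  qed
  have low: "p v \<le> f (t *\<^sub>R v) / t" if "t > 0" for t v
    unfolding p_def by (rule cINF_lower) (use that lb in \<open>auto intro!: bdd_belowI2\<close>)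
  have gr: "m \<le> p v" if "\<And>t. t > 0 \<Longrightarrow> m \<le> f (t *\<^sub>R v) / t" for m v
    unfolding p_def by (rule cINF_greatest) (use that in auto)
  have "sublinear p"
    unfolding sublinear_def
  proof (intro conjI allI impI)
    fix v w
    have "p (v + w) \<le> f (t *\<^sub>R v) / t + f (s *\<^sub>R w) / s" if "t > 0" "s > 0" for s t
      using low[of "t * s / (t + s)" "v + w"] persp[OF that, of v w] that by simp
    then have "p (v + w) - f (t *\<^sub>R v) / t \<le> p w" if "t > 0" for t
      using that by (intro gr) (smt (verit))
    then have "p (v + w) - p w \<le> p v" by (intro gr) (simp add: algebra_simps)
    then show "p (v + w) \<le> p v + p w" by linarith
  next
    fix c :: real and v assume c: "c > 0"
    have "p (c *\<^sub>R v) / c \<le> p v"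
    proof (rule gr)
      fix t :: real assume t: "t > 0"
      then show "p (c *\<^sub>R v) / c \<le> f (t *\<^sub>R v) / t"
        using low[of "t / c" "c *\<^sub>R v"] c by (simp add: field_simps)
    qed
    then show "p (c *\<^sub>R v) \<le> c * p v" using c by (simp add: field_simps)
  qed
  then obtain l where "linear l" "\<And>x. l x \<le> p x" using linear_below_sublinear by blast
  then show thesis using low[of 1] by (intro that) (auto intro: order_trans)
qed

text \<open>
  The set \<open>C\<close> plays the role of the epigraph of a convex function \<open>\<phi>\<close> that may take the value \<open>\<infinity>\<close>, and
  the hypothesis says \<open>- k (- z) \<le> \<phi> z\<close>. The infimal convolution \<open>f w = inf {\<phi> z + k (w - z) | z}\<close> is
  convex and \<open>f 0 \<ge> 0\<close>, so it has a linear minorant. Putting \<open>w = z + u\<close> splits the resulting inequality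
  into \<open>l u - k u \<le> \<phi> z - l z\<close>, with independent \<open>u\<close> and \<open>z\<close>; any constant in between, added
  to \<open>l\<close>, gives an affine function below \<open>\<phi>\<close> and above \<open>- k (- \<cdot>)\<close>.
\<close>

lemma convex_sandwich:
  fixes C :: "('v::real_vector \<times> real) set"
  assumes C: "convex C" "C \<noteq> {}" and k: "convex_on UNIV k"
    and nonneg: "\<And>z r. (z, r) \<in> C \<Longrightarrow> 0 \<le> r + k (- z)"
  obtains l where "linear l" "\<And>w z r. (z, r) \<in> C \<Longrightarrow> l w \<le> r + k (w - z)"
proof -
  define f where "f w = (INF c\<in>C. snd c + k (w - fst c))" for w
  have kc: "k (a *\<^sub>R x + b *\<^sub>R y) \<le> a * k x + b * k y" if "a \<ge> 0" "b \<ge> 0" "a + b = 1" for a b x y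
    using k that by (simp add: convex_on_def)
  have Cc: "a *\<^sub>R c + b *\<^sub>R d \<in> C" if "c \<in> C" "d \<in> C" "a \<ge> 0" "b \<ge> 0" "a + b = 1" for a b c d
    using C(1) that by (simp add: convex_def)
  have mix: "snd (a *\<^sub>R c + b *\<^sub>R d) + k ((a *\<^sub>R v + b *\<^sub>R w) - fst (a *\<^sub>R c + b *\<^sub>R d))
      \<le> a * (snd c + k (v - fst c)) + b * (snd d + k (w - fst d))"
    if "a \<ge> 0" "b \<ge> 0" "a + b = 1" for a b v w and c d :: "'v \<times> real"
    using kc[OF that, of "v - fst c" "w - fst d"] by (simp add: algebra_simps)
  obtain d where d: "d \<in> C" using C(2) by auto
  \<comment> \<open>Finiteness of \<open>f w\<close>: by convexity, \<open>f w + f (- w) \<ge> 2 f 0 \<ge> 0\<close>, and \<open>f (- w)\<close> is bounded above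
    by its value at the point \<open>d\<close>.\<close>
  have lb: "- (snd d + k (- w - fst d)) \<le> snd c + k (w - fst c)" if "c \<in> C" for c w
  proof -
    let ?m = "(1/2) *\<^sub>R c + (1/2) *\<^sub>R d"
    have "?m \<in> C" by (rule Cc[OF that d]) auto
    then have "(fst ?m, snd ?m) \<in> C" by (simp only: prod.collapse)
    then have "0 \<le> snd ?m + k (((1/2) *\<^sub>R w + (1/2) *\<^sub>R - w) - fst ?m)"
      using nonneg by fastforce
    also have "\<dots> \<le> (1/2) * (snd c + k (w - fst c)) + (1/2) * (snd d + k (- w - fst d))"
      by (rule mix) auto
    finally have "0 \<le> (1/2) * (snd c + k (w - fst c)) + (1/2) * (snd d + k (- w - fst d))" .
    moreover have "- b \<le> a" if "0 \<le> (1/2) * a + (1/2) * b" for a b :: real using that by simp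
    ultimately show ?thesis by blast
  qed
  have low: "f w \<le> snd c + k (w - fst c)" if "c \<in> C" for c w
    unfolding f_def by (rule cINF_lower) (use that lb in \<open>auto intro!: bdd_belowI2\<close>)
  have gr: "m \<le> f w" if "\<And>c. c \<in> C \<Longrightarrow> m \<le> snd c + k (w - fst c)" for m w
    unfolding f_def by (rule cINF_greatest) (use that C(2) in auto)
  have gr_scaled: "m \<le> a * f w"
    if "a > 0" "\<And>c. c \<in> C \<Longrightarrow> m \<le> a * (snd c + k (w - fst c))" for m w a
  proof -
    have "m / a \<le> f w" using that by (intro gr) (simp add: field_simps)
    then show ?thesis using that(1) by (simp add: field_simps)
  qed
  have "convex_on UNIV f"
  proof (rule convex_onI)
    fix t :: real and v w assume t: "0 < t" "t < 1"
    have "f ((1 - t) *\<^sub>R v + t *\<^sub>R w) \<le> (1 - t) * (snd c + k (v - fst c)) + t * (snd e + k (w - fst e))"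
      if "c \<in> C" "e \<in> C" for c e
      using low[OF Cc[OF that, of "1 - t" t], of "(1 - t) *\<^sub>R v + t *\<^sub>R w"]
        mix[of "1 - t" t c e v w] t by linarith
    then have "f ((1 - t) *\<^sub>R v + t *\<^sub>R w) - (1 - t) * (snd c + k (v - fst c)) \<le> t * f w"
      if "c \<in> C" for c
      using that t by (intro gr_scaled) (simp_all add: algebra_simps)
    then have "f ((1 - t) *\<^sub>R v + t *\<^sub>R w) - t * f w \<le> (1 - t) * f v"
      using t by (intro gr_scaled) (simp_all add: algebra_simps)
    then show "f ((1 - t) *\<^sub>R v + t *\<^sub>R w) \<le> (1 - t) * f v + t * f w" by linarith
  qed simp
  moreover have "f 0 \<ge> 0" by (rule gr) (use nonneg in auto)
  ultimately obtain l where l: "linear l" "\<And>x. l x \<le> f x" using linear_below_convex by blast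
  show thesis
  proof (rule that[OF l(1)])
    fix w z r assume "(z, r) \<in> C"
    then show "l w \<le> r + k (w - z)" using l(2)[of w] low[of "(z, r)" w] by simp
  qed
qed

section \<open>Norms and dual norms\<close>

lemma convex_on_half_norm_square:
  "convex_on UNIV (\<lambda>v::'v::real_normed_vector. (norm v)\<^sup>2 / 2)"
proof (rule convex_onI)
  fix t :: real and x y :: 'v assume t: "0 < t" "t < 1"
  have "(norm ((1 - t) *\<^sub>R x + t *\<^sub>R y))\<^sup>2 \<le> ((1 - t) * norm x + t * norm y)\<^sup>2"
    using norm_triangle_ineq[of "(1 - t) *\<^sub>R x" "t *\<^sub>R y"] t by (intro power_mono) auto
  also have "\<dots> = (1 - t) * (norm x)\<^sup>2 + t * (norm y)\<^sup>2 - t * (1 - t) * (norm x - norm y)\<^sup>2"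
    by (simp add: power2_eq_square algebra_simps)
  also have "\<dots> \<le> (1 - t) * (norm x)\<^sup>2 + t * (norm y)\<^sup>2" using t by simp
  finally show "(norm ((1 - t) *\<^sub>R x + t *\<^sub>R y))\<^sup>2 / 2 \<le> (1 - t) * ((norm x)\<^sup>2 / 2) + t * ((norm y)\<^sup>2 / 2)"
    by (simp add: field_simps)
qed simp

text \<open>
  The function \<open>\<parallel>\<cdot>\<parallel>\<^sup>2/2\<close> has conjugate \<open>\<parallel>\<cdot>\<parallel>\<^sup>2/2\<close> on the dual, and a finite value of the conjugate forces
  continuity of the linear function. Both come from optimizing the hypothesis over the multiples of \<open>v\<close>,
  which gives \<open>(h v)\<^sup>2 \<le> 2 c \<parallel>v\<parallel>\<^sup>2\<close>.
\<close>

lemma half_norm_square_conjugate: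
  fixes h :: "'v::real_normed_vector \<Rightarrow> real"
  assumes h: "linear h" and le: "\<And>v. h v \<le> (norm v)\<^sup>2 / 2 + c"
  obtains g where "\<And>v. blinfun_apply g v = h v" "(norm g)\<^sup>2 / 2 \<le> c"
proof -
  have c: "0 \<le> c" using le[of 0] linear_0[OF h] by simp
  have sq: "(h v)\<^sup>2 \<le> 2 * c * (norm v)\<^sup>2" for v
  proof (cases "v = 0")
    case False
    then have n: "norm v > 0" by simp
    \<comment> \<open>The multiple of \<open>v\<close> that maximizes \<open>h (\<lambda> v) - \<parallel>\<lambda> v\<parallel>\<^sup>2/2\<close> is the one with \<open>\<lambda> = h v / \<parallel>v\<parallel>\<^sup>2\<close>.\<close>
    have "h ((h v / (norm v)\<^sup>2) *\<^sub>R v) \<le> (norm ((h v / (norm v)\<^sup>2) *\<^sub>R v))\<^sup>2 / 2 + c" by (rule le)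
    also have "h ((h v / (norm v)\<^sup>2) *\<^sub>R v) = (h v)\<^sup>2 / (norm v)\<^sup>2"
      using linear_scale[OF h] by (simp add: power2_eq_square)
    also have "(norm ((h v / (norm v)\<^sup>2) *\<^sub>R v))\<^sup>2 = (h v)\<^sup>2 / (norm v)\<^sup>2"
      using n by (simp add: power_mult_distrib power_divide power2_eq_square)
    finally have "(h v)\<^sup>2 / (norm v)\<^sup>2 \<le> 2 * c" by simp
    then show ?thesis using n by (simp add: field_simps)
  qed (simp add: linear_0[OF h])
  have bound: "\<bar>h v\<bar> \<le> sqrt (2 * c) * norm v" for v
    using real_sqrt_le_mono[OF sq[of v]] by (simp add: real_sqrt_mult)
  then have "bounded_linear h"
    using h by (auto simp: linear_iff mult.commute intro!: bounded_linear_intro[where K = "sqrt (2 * c)"])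
  then have g: "blinfun_apply (Blinfun h) v = h v" for v by (simp add: bounded_linear_Blinfun_apply)
  have "norm (Blinfun h) \<le> sqrt (2 * c)" using bound c by (intro norm_blinfun_bound) (auto simp: g)
  then have "(norm (Blinfun h))\<^sup>2 \<le> (sqrt (2 * c))\<^sup>2" by (rule power_mono) simp
  then show thesis using g c by (intro that[of "Blinfun h"]) auto
qed

lemma blinfun_linear: "linear (blinfun_apply h)"
  by (simp add: bounded_linear.linear blinfun.bounded_linear_right)

lemma half_norm_square_conjugate_blinfun:
  fixes h :: "'v::real_normed_vector dual"
  assumes "\<And>v. blinfun_apply h v \<le> (norm v)\<^sup>2 / 2 + c"
  shows "(norm h)\<^sup>2 / 2 \<le> c"
proof -
  obtain g where "\<And>v. blinfun_apply g v = blinfun_apply h v" "(norm g)\<^sup>2 / 2 \<le> c"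
    using half_norm_square_conjugate[OF blinfun_linear assms] by blast
  then show ?thesis using blinfun_eqI[of g h] by simp
qed

text \<open>
  A norming functional for \<open>y\<close> is a subgradient of the norm at \<open>y\<close>, that is, a linear minorant of the
  convex function \<open>v \<mapsto> \<parallel>v + y\<parallel> - \<parallel>y\<parallel>\<close>.
\<close>

lemma norm_le_canonical_embedding: "norm y \<le> norm (canonical_embedding y)"
proof -
  have "convex_on UNIV (\<lambda>v. norm (v + y) - norm y)"
  proof (rule convex_onI)
    fix t :: real and v w assume t: "0 < t" "t < 1"
    have "(1 - t) *\<^sub>R v + t *\<^sub>R w + y = (1 - t) *\<^sub>R (v + y) + t *\<^sub>R (w + y)" by (simp add: algebra_simps)
    then have "norm ((1 - t) *\<^sub>R v + t *\<^sub>R w + y) \<le> (1 - t) * norm (v + y) + t * norm (w + y)"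
      using norm_triangle_ineq[of "(1 - t) *\<^sub>R (v + y)" "t *\<^sub>R (w + y)"] t by simp
    then show "norm ((1 - t) *\<^sub>R v + t *\<^sub>R w + y) - norm y
        \<le> (1 - t) * (norm (v + y) - norm y) + t * (norm (w + y) - norm y)"
      by (simp add: algebra_simps)
  qed simp
  then obtain l where l: "linear l" "\<And>v. l v \<le> norm (v + y) - norm y"
    by (rule linear_below_convex) auto
  have le: "l v \<le> norm v" for v using l(2)[of v] norm_triangle_ineq[of v y] by linarith
  have "\<bar>l v\<bar> \<le> norm v" for v using le[of v] le[of "- v"] linear_neg[OF l(1), of v] by auto
  then have bl: "bounded_linear l"
    using l(1) by (auto simp: linear_iff intro!: bounded_linear_intro[where K = 1])
  have L: "blinfun_apply (Blinfun l) v = l v" for v by (simp add: bounded_linear_Blinfun_apply[OF bl])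
  have "norm (Blinfun l) \<le> 1"
    using \<open>\<And>v. \<bar>l v\<bar> \<le> norm v\<close> by (intro norm_blinfun_bound) (auto simp: L)
  have "norm y \<le> l y" using l(2)[of "- y"] linear_neg[OF l(1), of y] by simp
  also have "\<dots> = canonical_embedding y (Blinfun l)" by (simp add: L)
  also have "\<dots> \<le> norm (canonical_embedding y) * norm (Blinfun l)"
    using norm_blinfun[of "canonical_embedding y" "Blinfun l"] by simp
  also have "\<dots> \<le> norm (canonical_embedding y)"
    using \<open>norm (Blinfun l) \<le> 1\<close> by (simp add: mult_left_le)
  finally show ?thesis .
qed

lemma half_squares_plus_pairing_nonneg:
  fixes h :: "'v::real_normed_vector dual"
  shows "0 \<le> (norm v)\<^sup>2 / 2 + (norm h)\<^sup>2 / 2 + h v"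
proof -
  have "- h v \<le> norm h * norm v" using norm_blinfun[of h v] by simp
  moreover have "0 \<le> (norm v - norm h)\<^sup>2" by simp
  ultimately show ?thesis by (simp add: power2_eq_square algebra_simps)
qed

section \<open>Maximally monotone sets\<close>

lemma maximally_monotone_memI:
  assumes A: "maximally_monotone_set A"
    and rel: "\<And>s s'. (s, s') \<in> A \<Longrightarrow> 0 \<le> blinfun_apply (s' - x') (s - x)"
  shows "(x, x') \<in> A"
proof -
  have "blinfun_apply (x' - s') (x - s) = blinfun_apply (s' - x') (s - x)" for s s'
    by (simp add: blinfun.diff_left blinfun.diff_right)
  then have "monotone_set (insert (x, x') A)"
    using A rel by (auto simp: maximally_monotone_set_def monotone_set_def)
  then have "insert (x, x') A = A" using A unfolding maximally_monotone_set_def by blast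
  then show ?thesis by blast
qed

lemma maximally_monotone_nonempty:
  assumes "maximally_monotone_set A" shows "A \<noteq> {}"
  using maximally_monotone_memI[OF assms, of 0 0] by auto

lemma maximally_monotone_translation:
  assumes A: "maximally_monotone_set A"
  shows "maximally_monotone_set {(s, s'). (s + x, s' + x') \<in> A}" (is "maximally_monotone_set ?T")
  unfolding maximally_monotone_set_def
proof (intro conjI allI impI)
  have "0 \<le> blinfun_apply ((s' + x') - (t' + x')) ((s + x) - (t + x))"
    if "(s + x, s' + x') \<in> A" "(t + x, t' + x') \<in> A" for s s' t t'
    using A that unfolding maximally_monotone_set_def monotone_set_def by blast
  then show "monotone_set ?T" by (auto simp: monotone_set_def)
  fix B assume B: "monotone_set B" "?T \<subseteq> B"
  have "(s + x, s' + x') \<in> A" if "(s, s') \<in> B" for s s'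
  proof (rule maximally_monotone_memI[OF A])
    fix t t' assume "(t, t') \<in> A"
    then have "(t - x, t' - x') \<in> B" using B(2) by auto
    then have "0 \<le> blinfun_apply ((t' - x') - s') ((t - x) - s)"
      using B(1) that unfolding monotone_set_def by blast
    then show "0 \<le> blinfun_apply (t' - (s' + x')) (t - (s + x))" by (simp add: algebra_simps)
  qed
  then show "B = ?T" using B(2) by auto
qed

text \<open>
  The Fitzpatrick function of \<open>A\<close> may be infinite; its epigraph is a convex set of real data that carries
  the same information.
\<close>

definition fitzpatrick_epigraph ::
    "('v::real_normed_vector \<times> 'v dual) set \<Rightarrow> (('v \<times> 'v dual) \<times> real) set"
  where "fitzpatrick_epigraph A =
    {((x, x'), r). \<forall>(s, s')\<in>A. blinfun_apply s' x + blinfun_apply x' s - blinfun_apply s' s \<le> r}"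

lemma convex_fitzpatrick_epigraph: "convex (fitzpatrick_epigraph A)"
proof -
  have "a * (blinfun_apply s' x + blinfun_apply x' s - blinfun_apply s' s)
      + b * (blinfun_apply s' y + blinfun_apply y' s - blinfun_apply s' s)
    = blinfun_apply s' (a *\<^sub>R x + b *\<^sub>R y) + blinfun_apply (a *\<^sub>R x' + b *\<^sub>R y') s - blinfun_apply s' s"
    if "a + b = 1" for a b x y x' y' s s'
    unfolding blinfun.add_left blinfun.add_right blinfun.scaleR_left blinfun.scaleR_right real_scaleR_def
    using that by algebra
  note eq = this[symmetric]
  show ?thesis
    unfolding convex_def fitzpatrick_epigraph_def
    by (auto simp: eq intro!: add_mono mult_left_mono)
qed

lemma graph_in_fitzpatrick_epigraph:
  assumes "monotone_set A" "(x, x') \<in> A"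
  shows "((x, x'), blinfun_apply x' x) \<in> fitzpatrick_epigraph A"
proof -
  have "0 \<le> blinfun_apply (x' - s') (x - s)" if "(s, s') \<in> A" for s s'
    using assms that unfolding monotone_set_def by blast
  then show ?thesis
    by (fastforce simp: fitzpatrick_epigraph_def blinfun.diff_left blinfun.diff_right)
qed

text \<open>
  If the Fitzpatrick function were below the pairing at \<open>(x, x')\<close>, then \<open>\<langle>s - x, s' - x'\<rangle> > 0\<close> on all of \<open>A\<close>,
  so \<open>(x, x') \<in> A\<close> by maximality; but then \<open>(s, s') = (x, x')\<close> contributes \<open>\<langle>x, x'\<rangle>\<close> to the supremum.
\<close>

lemma pairing_le_fitzpatrick:
  assumes A: "maximally_monotone_set A" and r: "((x, x'), r) \<in> fitzpatrick_epigraph A"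
  shows "blinfun_apply x' x \<le> r"
proof (rule ccontr)
  assume less: "\<not> blinfun_apply x' x \<le> r"
  have le: "blinfun_apply s' x + blinfun_apply x' s - blinfun_apply s' s \<le> r" if "(s, s') \<in> A" for s s'
    using r that by (auto simp: fitzpatrick_epigraph_def)
  have "(x, x') \<in> A"
    using le less by (intro maximally_monotone_memI[OF A])
      (fastforce simp: blinfun.diff_left blinfun.diff_right)
  from le[OF this] less show False by simp
qed

section \<open>Quasidensity\<close>

text \<open>
  Both uses of maximality meet here: it makes the sandwich theorem applicable to the Fitzpatrick
  function, and it puts the functional so obtained into \<open>A\<close>.
\<close>

lemma maximally_monotone_attains_at_origin:
  fixes A :: "('v::real_normed_vector \<times> 'v dual) set"
  assumes refl: "reflexive_space TYPE('v)" and A: "maximally_monotone_set A"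
  obtains y y' where "(y, y') \<in> A" "(norm y)\<^sup>2 / 2 + (norm y')\<^sup>2 / 2 + blinfun_apply y' y \<le> 0"
proof -
  let ?C = "fitzpatrick_epigraph A"
  have mono: "monotone_set A" using A by (simp add: maximally_monotone_set_def)
  obtain a a' where a: "(a, a') \<in> A" using maximally_monotone_nonempty[OF A] by auto
  have norm2: "(norm (x, x'))\<^sup>2 = (norm x)\<^sup>2 + (norm x')\<^sup>2" for x :: 'v and x' :: "'v dual"
    by (simp add: norm_Pair)
  have nonneg: "0 \<le> r + (norm (- z))\<^sup>2 / 2" if "(z, r) \<in> ?C" for z r
  proof -
    obtain x x' where z: "z = (x, x')" by (cases z)
    show ?thesis
      using pairing_le_fitzpatrick[OF A, of x x' r] half_squares_plus_pairing_nonneg[of x x'] that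
      by (simp add: z norm2 add_divide_distrib)
  qed
  have ne: "?C \<noteq> {}" using graph_in_fitzpatrick_epigraph[OF mono a] by auto
  obtain l where l: "linear l" "\<And>w z r. (z, r) \<in> ?C \<Longrightarrow> l w \<le> r + (norm (w - z))\<^sup>2 / 2"
    using convex_sandwich[OF convex_fitzpatrick_epigraph ne convex_on_half_norm_square nonneg] by blast
  \<comment> \<open>The sandwich inequality at \<open>w = (s, s') + (x, x')\<close> and \<open>z = (s, s')\<close>.\<close>
  have key: "l (x, 0) + l (0, x') \<le> (norm x)\<^sup>2 / 2 + (norm x')\<^sup>2 / 2 + (blinfun_apply s' s - l (s, s'))"
    if "(s, s') \<in> A" for s s' x x'
  proof -
    have "l ((s, s') + ((x, 0) + (0, x'))) = l (s, s') + (l (x, 0) + l (0, x'))"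
      by (simp only: linear_add[OF l(1)])
    then show ?thesis
      using l(2)[OF graph_in_fitzpatrick_epigraph[OF mono that], of "(s, s') + (x, x')"]
      by (simp add: norm2 add_divide_distrib)
  qed
  have lin1: "linear (\<lambda>x. l (x, 0))"
    using linear_compose[of "\<lambda>x. (x, 0)" l] l(1) by (simp add: o_def linear_iff)
  have lin2: "linear (\<lambda>x'. l (0, x'))"
    using linear_compose[of "\<lambda>x'. (0, x')" l] l(1) by (simp add: o_def linear_iff)
  have "l (x, 0) \<le> (norm x)\<^sup>2 / 2 + (a' a - l (a, a'))" for x
    using key[OF a, of x 0] linear_0[OF lin2] by simp
  then obtain y' :: "'v dual" where y': "\<And>x. blinfun_apply y' x = l (x, 0)"
    by (rule half_norm_square_conjugate[OF lin1]) blast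
  have "l (0, x') \<le> (norm x')\<^sup>2 / 2 + (a' a - l (a, a'))" for x'
    using key[OF a, of 0 x'] linear_0[OF lin1] by simp
  then obtain y'' :: "'v dual dual" where y'': "\<And>x'. blinfun_apply y'' x' = l (0, x')"
    by (rule half_norm_square_conjugate[OF lin2]) blast
  obtain y where y: "canonical_embedding y = y''"
    using refl unfolding reflexive_space_def surj_def by metis
  have yl: "blinfun_apply x' y = l (0, x')" for x' using y'' by (simp flip: y)
  have ls: "l (s, s') = y' s + s' y" for s s'
    using linear_add[OF l(1), of "(s, 0)" "(0, s')"] by (simp add: y' yl)
  have dual: "(norm y)\<^sup>2 / 2 + (norm y')\<^sup>2 / 2 \<le> s' s - y' s - s' y" if s: "(s, s') \<in> A" for s s'
  proof -
    \<comment> \<open>Conjugation in the two variables separately: first in \<open>x\<close> for fixed \<open>x'\<close>, then in \<open>x'\<close>.\<close>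
    have *: "(norm y')\<^sup>2 / 2 \<le> (norm x')\<^sup>2 / 2 + (s' s - l (s, s')) - y'' x'" for x'
    proof -
      have "y' x \<le> (norm x)\<^sup>2 / 2 + ((norm x')\<^sup>2 / 2 + (s' s - l (s, s')) - y'' x')" for x
        using key[OF s, of x x'] by (simp add: y' y'')
      then show ?thesis
        by (rule half_norm_square_conjugate_blinfun)
    qed
    have "y'' x' \<le> (norm x')\<^sup>2 / 2 + ((s' s - l (s, s')) - (norm y')\<^sup>2 / 2)" for x'
      using *[of x'] by simp
    then have "(norm y'')\<^sup>2 / 2 \<le> (s' s - l (s, s')) - (norm y')\<^sup>2 / 2"
      by (rule half_norm_square_conjugate_blinfun)
    moreover have "(norm y)\<^sup>2 \<le> (norm y'')\<^sup>2"
      using norm_le_canonical_embedding[of y] unfolding y by (rule power_mono) simp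
    ultimately show ?thesis unfolding ls by linarith
  qed
  have "(y, y') \<in> A"
  proof (rule maximally_monotone_memI[OF A])
    fix s s' assume "(s, s') \<in> A"
    then show "0 \<le> blinfun_apply (s' - y') (s - y)"
      using dual[of s s'] half_squares_plus_pairing_nonneg[of y y']
      by (simp add: blinfun.diff_left blinfun.diff_right)
  qed
  moreover have "(norm y)\<^sup>2 / 2 + (norm y')\<^sup>2 / 2 + y' y \<le> 0" using dual[OF calculation] by simp
  ultimately show thesis by (rule that)
qed

theorem corollary6p13:
  fixes S :: "'a::banach \<Rightarrow> 'a dual set"
  assumes "\<exists>x::'a. x \<noteq> 0"
    and "reflexive_space TYPE('a)"
    and "maximally_monotone S"
  shows "quasidense S"
  unfolding quasidense_def
proof (intro allI)
  fix x :: 'a and x' :: "'a dual"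
  have "maximally_monotone_set {(s, s'). (s + x, s' + x') \<in> graph_of S}"
    using assms(3) unfolding maximally_monotone_def by (rule maximally_monotone_translation)
  then obtain y y' where y: "(y + x, y' + x') \<in> graph_of S"
    and le: "(norm y)\<^sup>2 / 2 + (norm y')\<^sup>2 / 2 + blinfun_apply y' y \<le> 0"
    using maximally_monotone_attains_at_origin[OF assms(2)] by (metis (no_types, lifting) case_prodD mem_Collect_eq)
  show "(INF (s, s') \<in> graph_of S.
      ereal ((norm (s - x))\<^sup>2 / 2 + (norm (s' - x'))\<^sup>2 / 2 + blinfun_apply (s' - x') (s - x))) \<le> 0"
    by (rule INF_lower2[OF y]) (use le in simp)
qed

end
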